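(* For every integer $n \ge 1$ there exists a two-parameter Source-Sink Monotone (SSM) parametric network with source $s$, sink $t$ and $n$ internal nodes $N$ such that every one of the $2^n$ $s$--$t$ cuts is the unique minimum $s$--$t$ cut for some values of the parameters. That is, for every $S \subseteq N$ there are parameter values $(\lambda,\mu)$ at which $\{s\}\cup S$ is the unique minimum $s$--$t$ cut.
   Context: A two-parameter parametric network is a directed network with source $s$, sink $t$ and a set $N$ of internal nodes. Each arc $i\to j$ has capacity $u_{ij}(\lambda,\mu)=a_{ij}\lambda+b_{ij}\mu+c_{ij}$, where $(\lambda,\mu)$ are real parameters restricted to values at which all capacities are non-negative. The network is Source-Sink Monotone (SSM) if the following three conditions hold: - every arc $s\to j$ out of the source has capacity non-decreasing in each parameter, i.e. $a_{sj},b_{sj}\ge 0$; - every arc $i\to t$ into the sink has capacity non-increasing in each parameter, i.e. $a_{it},b_{it}\le 0$; - every other arc has constant capacity, i.e. $a_{ij}=b_{ij}=0$. An $s$--$t$ cut is a set of the form $\{s\}\cup S$ with $S\subseteq N$. Its capacity is the total capacity of the arcs leaving it. *)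

theory Defs
  imports Complex_Main "Graph_Theory.Pair_Digraph"
begin

text \<open>
  An arc from \<open>i\<close> to \<open>j\<close> is the pair \<open>(i, j)\<close>; the values of the coefficient functions
  at pairs that are not arcs play no role.
\<close>

record 'v param_network =
  graph :: "'v pair_pre_digraph"
  source :: 'v
  sink :: 'v
  coeff_a :: "'v \<Rightarrow> 'v \<Rightarrow> real"
  coeff_b :: "'v \<Rightarrow> 'v \<Rightarrow> real"
  coeff_c :: "'v \<Rightarrow> 'v \<Rightarrow> real"

definition two_param_network :: "'v param_network \<Rightarrow> bool" where
  "two_param_network P \<longleftrightarrow>
     pair_fin_digraph (graph P) \<and>
     source P \<in> pverts (graph P) \<and> sink P \<in> pverts (graph P) \<and> source P \<noteq> sink P"

definition internal_nodes :: "'v param_network \<Rightarrow> 'v set" where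
  "internal_nodes P = pverts (graph P) - {source P, sink P}"

definition capacity :: "'v param_network \<Rightarrow> real \<Rightarrow> real \<Rightarrow> 'v \<Rightarrow> 'v \<Rightarrow> real" where
  "capacity P lam mu i j = coeff_a P i j * lam + coeff_b P i j * mu + coeff_c P i j"

definition admissible :: "'v param_network \<Rightarrow> real \<Rightarrow> real \<Rightarrow> bool" where
  "admissible P lam mu \<longleftrightarrow> (\<forall>(i, j) \<in> parcs (graph P). 0 \<le> capacity P lam mu i j)"

text \<open>
  An arc from source to sink falls under both monotonicity conditions and hence has constant
  capacity. Arcs into the source or out of the sink are allowed.
\<close>

definition source_sink_monotone :: "'v param_network \<Rightarrow> bool" where
  "source_sink_monotone P \<longleftrightarrow>
     (\<forall>(i, j) \<in> parcs (graph P).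
        (i = source P \<longrightarrow> 0 \<le> coeff_a P i j \<and> 0 \<le> coeff_b P i j) \<and>
        (j = sink P \<longrightarrow> coeff_a P i j \<le> 0 \<and> coeff_b P i j \<le> 0) \<and>
        (i \<noteq> source P \<and> j \<noteq> sink P \<longrightarrow> coeff_a P i j = 0 \<and> coeff_b P i j = 0))"

definition st_cut :: "'v param_network \<Rightarrow> 'v set \<Rightarrow> bool" where
  "st_cut P X \<longleftrightarrow> (\<exists>S \<subseteq> internal_nodes P. X = {source P} \<union> S)"

definition leaving_arcs :: "'v param_network \<Rightarrow> 'v set \<Rightarrow> ('v \<times> 'v) set" where
  "leaving_arcs P X = {(i, j) \<in> parcs (graph P). i \<in> X \<and> j \<notin> X}"

definition cut_capacity :: "'v param_network \<Rightarrow> real \<Rightarrow> real \<Rightarrow> 'v set \<Rightarrow> real" where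
  "cut_capacity P lam mu X = (\<Sum>(i, j) \<in> leaving_arcs P X. capacity P lam mu i j)"

definition unique_min_st_cut :: "'v param_network \<Rightarrow> real \<Rightarrow> real \<Rightarrow> 'v set \<Rightarrow> bool" where
  "unique_min_st_cut P lam mu X \<longleftrightarrow>
     st_cut P X \<and>
     (\<forall>Y. st_cut P Y \<and> Y \<noteq> X \<longrightarrow> cut_capacity P lam mu X < cut_capacity P lam mu Y)"

end

theory Submission
  imports Defs
begin

text \<open>
  Join the internal nodes \<open>1, \<dots>, n\<close> by arcs \<open>j \<rightarrow> i\<close> (\<open>i < j\<close>) and let \<open>\<epsilon>\<close> be tiny compared with a
  small \<open>d\<close>. Target the parameter points \<open>y\<^sub>S = \<Sum>\<^sub>i\<^sub>\<in>\<^sub>S v\<^sub>i\<close> with \<open>v\<^sub>i = d\<^sup>i (i + 1, -1)\<close>, and let the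
  source arc of node \<open>j\<close> vary as \<open>p\<^sub>j \<bullet> y\<close> with \<open>p\<^sub>j = \<epsilon>\<^sup>j (1, j)\<close>. Then \<open>p\<^sub>j \<bullet> v\<^sub>i \<le> 0\<close> for \<open>i < j\<close>, while
  \<open>p\<^sub>j \<bullet> v\<^sub>j > 0\<close>. The arcs \<open>j \<rightarrow> i\<close> of capacity \<open>- p\<^sub>j \<bullet> v\<^sub>i\<close> cancel the influence of the nodes before
  \<open>j\<close>, that of the later ones is negligible as \<open>d\<close> is small, and so \<open>p\<^sub>j \<bullet> v\<^sub>j\<close> decides whether \<open>j\<close> belongs
  to the minimum cut at \<open>y\<^sub>S\<close>, namely exactly if \<open>j \<in> S\<close>. As the nodes have weights \<open>\<epsilon>\<^sup>j\<close>, two cuts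
  are compared at the first node where they differ.
\<close>

text \<open>
  Up to a constant independent of \<open>T\<close>, the capacity of the cut \<open>{s} \<union> T\<close> when node \<open>j\<close> has source
  capacity \<open>p j * x + q j * y\<close> and sink capacity \<open>g j\<close>, and the arc from \<open>j\<close> down to \<open>i\<close> has capacity
  \<open>e i j\<close> (note the order of the arguments).
\<close>

definition reduced_cost ::
  "(nat \<Rightarrow> real) \<Rightarrow> (nat \<Rightarrow> real) \<Rightarrow> (nat \<Rightarrow> real) \<Rightarrow> (nat \<Rightarrow> nat \<Rightarrow> real) \<Rightarrow>
    real \<Rightarrow> real \<Rightarrow> nat set \<Rightarrow> real" where
  "reduced_cost p q g e x y T =
     (\<Sum>j\<in>T. g j - (p j * x + q j * y) + (\<Sum>i\<in>{1..<j} - T. e i j))"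

text \<open>The first term that need not vanish decides the sign: it is at least
  \<open>\<epsilon> ^ k * c\<close>, while the fewer than \<open>n + 1\<close> terms after it carry
  a further factor \<open>\<epsilon>\<close> and total less than that in absolute value.\<close>

lemma sum_power_pos:
  fixes h :: "nat \<Rightarrow> real"
  assumes k: "k \<in> {1..n}" and zero: "\<And>j. j \<in> {1..<k} \<Longrightarrow> h j = 0" and "c \<le> h k"
    and bound: "\<And>j. j \<in> {1..n} \<Longrightarrow> \<bar>h j\<bar> \<le> M"
    and eps: "0 < \<epsilon>" "\<epsilon> \<le> 1" and small: "\<epsilon> * (real n * M) < c"
  shows "0 < (\<Sum>j\<in>{1..n}. \<epsilon> ^ j * h j)"
proof -
  have M: "0 \<le> M" using bound[OF k] by linarith
  have split: "{1..n} = {1..<k} \<union> insert k {k<..n}" using k by auto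
  have "(\<Sum>j\<in>{1..n}. \<epsilon> ^ j * h j)
      = (\<Sum>j\<in>{1..<k}. \<epsilon> ^ j * h j) + (\<Sum>j\<in>insert k {k<..n}. \<epsilon> ^ j * h j)"
    unfolding split by (rule sum.union_disjoint) auto
  then have eq: "(\<Sum>j\<in>{1..n}. \<epsilon> ^ j * h j) = \<epsilon> ^ k * h k + (\<Sum>j\<in>{k<..n}. \<epsilon> ^ j * h j)"
    using zero by simp
  have "- (\<epsilon> ^ Suc k * M) \<le> \<epsilon> ^ j * h j" if "j \<in> {k<..n}" for j
  proof -
    have "\<bar>\<epsilon> ^ j * h j\<bar> \<le> \<epsilon> ^ Suc k * M"
      unfolding abs_mult using that bound[of j] k eps M
      by (intro mult_mono) (auto intro: power_decreasing simp del: power_Suc)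
    then show ?thesis by linarith
  qed
  then have "of_nat (card {k<..n}) * (- (\<epsilon> ^ Suc k * M)) \<le> (\<Sum>j\<in>{k<..n}. \<epsilon> ^ j * h j)"
    by (rule sum_bounded_below)
  moreover have "real (card {k<..n}) * (\<epsilon> ^ Suc k * M) \<le> real n * (\<epsilon> ^ Suc k * M)"
    using eps M by (intro mult_right_mono) auto
  moreover have "real n * (\<epsilon> ^ Suc k * M) < \<epsilon> ^ k * c"
    using mult_strict_left_mono[OF small, of "\<epsilon> ^ k"] eps by (simp add: algebra_simps)
  moreover have "\<epsilon> ^ k * c \<le> \<epsilon> ^ k * h k"
    using \<open>c \<le> h k\<close> eps by (intro mult_left_mono) auto
  ultimately show ?thesis unfolding eq by simp
qed

text \<open>The combinatorial core, free of networks. The signs of \<open>p\<close> and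
  \<open>q\<close> yield monotonicity, that of \<open>e\<close> admissible inner arcs;
  \<open>g\<close> may be negative, since a constant is added to the sink capacities later.\<close>

lemma exists_separating_weights:
  fixes n :: nat
  assumes "n \<ge> 1"
  obtains p q g :: "nat \<Rightarrow> real" and e :: "nat \<Rightarrow> nat \<Rightarrow> real" and X Y :: "nat set \<Rightarrow> real"
  where "\<And>j. 0 \<le> p j" "\<And>j. 0 \<le> q j" "\<And>i j. i < j \<Longrightarrow> 0 \<le> e i j"
    "\<And>S T. S \<subseteq> {1..n} \<Longrightarrow> T \<subseteq> {1..n} \<Longrightarrow> T \<noteq> S \<Longrightarrow>
       reduced_cost p q g e (X S) (Y S) S < reduced_cost p q g e (X S) (Y S) T"
proof -
  \<comment> \<open>\<open>N\<close> bounds a sum of at most \<open>n\<close> terms of size at most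
    \<open>n + 1\<close>. The choice of \<open>d\<close> gives
    \<open>d ^ Suc k * N = d ^ k / 4\<close>, half of the threshold built into
    \<open>g\<close>.\<close>
  define N where "N = (real n + 1)\<^sup>2"
  define d :: real where "d = 1 / (4 * N)"
  have N: "1 \<le> N" unfolding N_def by (simp add: one_le_power)
  then have "1 \<le> 4 * N" by linarith
  then have d: "0 < d" "d \<le> 1" unfolding d_def by simp_all
  \<comment> \<open>Twice the bound on \<open>B\<close> below, because \<open>h\<close> is a
    difference of two such values.\<close>
  define M :: real where "M = 2 * (1 + 2 * N)"
  have M: "0 < M" using N unfolding M_def by simp
  \<comment> \<open>A lower bound for the gaps \<open>d ^ k / 4\<close>, uniform in
    \<open>k \<le> n\<close>.\<close>
  define c :: real where "c = d ^ n / 4"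
  have c: "0 < c" using d by (simp add: c_def)
  define \<epsilon> :: real where "\<epsilon> = min 1 (c / (2 * (real n * M)))"
  have nM: "0 < real n * M" using M assms by simp
  have eps: "0 < \<epsilon>" "\<epsilon> \<le> 1" using c nM by (auto simp: \<epsilon>_def)
  have "\<epsilon> * (real n * M) \<le> c / (2 * (real n * M)) * (real n * M)"
    using nM by (intro mult_right_mono) (auto simp: \<epsilon>_def)
  also have "\<dots> < c" using nM c by simp
  finally have small: "\<epsilon> * (real n * M) < c" .

  \<comment> \<open>The product of \<open>p\<^sub>j\<close> and \<open>v\<^sub>i\<close>, divided by
    \<open>\<epsilon> ^ j\<close>. It is at most 0 for \<open>i < j\<close>, as then
    \<open>i + 1 \<le> j\<close>, and equals \<open>d ^ j\<close> for \<open>i = j\<close>.\<close>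
  define r :: "nat \<Rightarrow> nat \<Rightarrow> real" where "r j i = d ^ i * (real i + 1 - real j)" for i j
  define e where "e i j = - (\<epsilon> ^ j * r j i)" for i j
  define p where "p j = \<epsilon> ^ j" for j :: nat
  define q where "q j = \<epsilon> ^ j * real j" for j
  \<comment> \<open>The threshold \<open>d ^ j / 2\<close> lies midway between 0 and
    \<open>r j j\<close>. Subtracting the full sum of \<open>e\<close> turns the cost of arcs to
    nodes outside \<open>T\<close> into a credit for the nodes inside \<open>T\<close>.\<close>
  define g where "g j = \<epsilon> ^ j * (d ^ j / 2) - (\<Sum>i\<in>{1..<j}. e i j)" for j
  define X where "X S = (\<Sum>i\<in>S. d ^ i * (real i + 1))" for S
  define Y where "Y S = (\<Sum>i\<in>S. - (d ^ i))" for S :: "nat set"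
  \<comment> \<open>Node \<open>j\<close> of \<open>T\<close> contributes
    \<open>\<epsilon> ^ j * B S T j\<close> at the point chosen for \<open>S\<close>. This depends
    on \<open>T\<close> only through nodes before \<open>j\<close>, which makes the first difference
    decisive.\<close>
  define B where "B S T j = d ^ j / 2 + (\<Sum>i\<in>{1..<j} \<inter> T. r j i) - (\<Sum>i\<in>S. r j i)" for S T j

  have cost: "reduced_cost p q g e (X S) (Y S) T = (\<Sum>j\<in>T. \<epsilon> ^ j * B S T j)" for S T
    unfolding reduced_cost_def
  proof (rule sum.cong)
    fix j assume "j \<in> T"
    have "p j * X S + q j * Y S = \<epsilon> ^ j * (\<Sum>i\<in>S. r j i)"
      unfolding p_def q_def X_def Y_def r_def sum_distrib_left sum.distrib[symmetric]
      by (rule sum.cong) (auto simp: algebra_simps)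
    moreover have "(\<Sum>i\<in>{1..<j}. e i j) = (\<Sum>i\<in>{1..<j} \<inter> T. e i j) + (\<Sum>i\<in>{1..<j} - T. e i j)"
      by (rule sum.Int_Diff) simp
    moreover have "(\<Sum>i\<in>{1..<j} \<inter> T. e i j) = - (\<epsilon> ^ j * (\<Sum>i\<in>{1..<j} \<inter> T. r j i))"
      unfolding e_def by (simp add: sum_negf sum_distrib_left)
    ultimately show "g j - (p j * X S + q j * Y S) + (\<Sum>i\<in>{1..<j} - T. e i j) = \<epsilon> ^ j * B S T j"
      unfolding g_def B_def by (simp add: algebra_simps)
  qed simp

  have r_bound: "\<bar>r j i\<bar> \<le> d ^ i * (real n + 1)" if "i \<in> {1..n}" "j \<in> {1..n}" for i j
    unfolding r_def abs_mult using that d by (intro mult_mono) auto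
  have r_bound1: "\<bar>r j i\<bar> \<le> real n + 1" if "i \<in> {1..n}" "j \<in> {1..n}" for i j
  proof -
    have "d ^ i * (real n + 1) \<le> 1 * (real n + 1)"
      using d by (intro mult_right_mono power_le_one) auto
    then show ?thesis using order_trans[OF r_bound[OF that]] by simp
  qed
  have r_sum: "\<bar>\<Sum>i\<in>A. r j i\<bar> \<le> m * N"
    if "A \<subseteq> {1..n}" "0 \<le> m" "\<And>i. i \<in> A \<Longrightarrow> \<bar>r j i\<bar> \<le> m * (real n + 1)" for A j m
  proof -
    have "\<bar>\<Sum>i\<in>A. r j i\<bar> \<le> (\<Sum>i\<in>A. \<bar>r j i\<bar>)" by (rule sum_abs)
    also have "\<dots> \<le> of_nat (card A) * (m * (real n + 1))" using that by (intro sum_bounded_above)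
    also have "\<dots> \<le> (real n + 1) * (m * (real n + 1))"
      using card_mono[OF _ that(1)] that(2) by (intro mult_right_mono) auto
    finally show ?thesis by (simp add: N_def power2_eq_square algebra_simps)
  qed
  have B_bound: "\<bar>B S T j\<bar> \<le> 1 + 2 * N" if "S \<subseteq> {1..n}" "T \<subseteq> {1..n}" "j \<in> {1..n}" for S T j
  proof -
    have "\<bar>\<Sum>i\<in>{1..<j} \<inter> T. r j i\<bar> \<le> 1 * N" "\<bar>\<Sum>i\<in>S. r j i\<bar> \<le> 1 * N"
      using that by (intro r_sum; use r_bound1[of _ j] in auto)+
    moreover have "0 \<le> d ^ j" "d ^ j \<le> 1" using d by (auto intro: power_le_one)
    ultimately show ?thesis unfolding B_def by linarith
  qed
  show ?thesis
  proof (rule that[where p = p and q = q and g = g and e = e and X = X and Y = Y])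
    show "0 \<le> p j" "0 \<le> q j" for j using eps by (auto simp: p_def q_def)
    show "0 \<le> e i j" if "i < j" for i j
      using that eps d by (auto simp: e_def r_def intro!: mult_nonneg_nonpos)
  next
    fix S T assume S: "S \<subseteq> {1..n}" and T: "T \<subseteq> {1..n}" and "T \<noteq> S"
    define h where "h j = (if j \<in> T then B S T j else 0) - (if j \<in> S then B S S j else 0)" for j
    define k where "k = (LEAST k. k \<in> S \<longleftrightarrow> k \<notin> T)"
    have "\<exists>k. k \<in> S \<longleftrightarrow> k \<notin> T" using \<open>T \<noteq> S\<close> by blast
    then have kdiff: "k \<in> S \<longleftrightarrow> k \<notin> T" unfolding k_def by (rule LeastI_ex)
    have below: "j \<in> S \<longleftrightarrow> j \<in> T" if "j < k" for j using not_less_Least[of j] that k_def by blast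
    have k: "k \<in> {1..n}" using kdiff S T by auto
    have same: "{1..<j} \<inter> T = {1..<j} \<inter> S" if "j \<le> k" for j using below that by auto
    \<comment> \<open>Since \<open>S\<close> and \<open>T\<close> agree before \<open>k\<close>, the
      inner arcs cancel the influence of those nodes.\<close>
    have Bk: "B S T k = d ^ k / 2 - (\<Sum>i\<in>S \<inter> {k..}. r k i)"
    proof -
      have "(\<Sum>i\<in>S. r k i) = (\<Sum>i\<in>S \<inter> {k..}. r k i) + (\<Sum>i\<in>S - {k..}. r k i)"
        using S finite_subset by (intro sum.Int_Diff) auto
      moreover have "S - {k..} = {1..<k} \<inter> T" using S below by auto
      ultimately show ?thesis unfolding B_def by simp
    qed
    have hk: "c \<le> h k"
    proof -
      have ck: "c \<le> d ^ k / 4" unfolding c_def using k d by (auto intro: power_decreasing)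
      show ?thesis
      proof (cases "k \<in> S")
        case True
        \<comment> \<open>All summands are positive, so the one at \<open>k\<close> alone already
          forces \<open>B S T k \<le> - d ^ k / 2\<close>: leaving \<open>k\<close> out of
          \<open>T\<close> forgoes this gain.\<close>
        have "r k k \<le> (\<Sum>i\<in>S \<inter> {k..}. r k i)"
          using True S d by (intro member_le_sum) (auto simp: r_def intro: finite_subset)
        moreover have "r k k = d ^ k" by (simp add: r_def)
        moreover have "B S S k = B S T k" unfolding B_def using same[of k] by simp
        moreover have "0 < d ^ k" using d by simp
        ultimately show ?thesis using True kdiff Bk ck unfolding h_def by auto
      next
        case False
        \<comment> \<open>Without \<open>k\<close> the sum starts at \<open>Suc k\<close>, too small
          to offset the threshold, so including \<open>k\<close> in \<open>T\<close> costs at least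
          \<open>d ^ k / 4\<close>.\<close>
        have "\<bar>\<Sum>i\<in>S \<inter> {k..}. r k i\<bar> \<le> (d ^ Suc k) * N"
        proof (rule r_sum)
          fix i assume i: "i \<in> S \<inter> {k..}"
          then have ki: "Suc k \<le> i" using False by (cases "i = k") auto
          have "\<bar>r k i\<bar> \<le> d ^ i * (real n + 1)" using i S k by (intro r_bound) auto
          also have "\<dots> \<le> d ^ Suc k * (real n + 1)"
            using ki d by (intro mult_right_mono power_decreasing) auto
          finally show "\<bar>r k i\<bar> \<le> d ^ Suc k * (real n + 1)" .
        qed (use S d in auto)
        also have "\<dots> = d ^ k / 4" using N by (simp add: d_def)
        finally show ?thesis using False kdiff Bk ck unfolding h_def by auto
      qed
    qed
    have "0 < (\<Sum>j\<in>{1..n}. \<epsilon> ^ j * h j)"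
    proof (rule sum_power_pos[where h = h, OF k _ hk _ eps small])
      show "h j = 0" if "j \<in> {1..<k}" for j
        using that below[of j] same[of j] by (simp add: h_def B_def)
      show "\<bar>h j\<bar> \<le> M" if "j \<in> {1..n}" for j
        using B_bound[OF S T that] B_bound[OF S S that] N by (auto simp: h_def M_def)
    qed
    also have "(\<Sum>j\<in>{1..n}. \<epsilon> ^ j * h j) = (\<Sum>j\<in>T. \<epsilon> ^ j * B S T j) - (\<Sum>j\<in>S. \<epsilon> ^ j * B S S j)"
    proof -
      have restrict: "(\<Sum>j\<in>A. \<epsilon> ^ j * f j) = (\<Sum>j\<in>{1..n}. \<epsilon> ^ j * (if j \<in> A then f j else 0))"
        if "A \<subseteq> {1..n}" for A f
        using that by (intro sum.mono_neutral_cong_left) auto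
      show ?thesis unfolding restrict[OF S] restrict[OF T] h_def
        by (simp add: sum_subtractf algebra_simps)
    qed
    finally show "reduced_cost p q g e (X S) (Y S) S < reduced_cost p q g e (X S) (Y S) T"
      unfolding cost by simp
  qed
qed

text \<open>
  The constant \<open>K\<close> raises source and sink capacities alike, which makes them non-negative without
  affecting the comparison of cuts.
\<close>

definition tournament_network ::
  "nat \<Rightarrow> real \<Rightarrow> (nat \<Rightarrow> real) \<Rightarrow> (nat \<Rightarrow> real) \<Rightarrow> (nat \<Rightarrow> real) \<Rightarrow> (nat \<Rightarrow> nat \<Rightarrow> real) \<Rightarrow>
    nat param_network" where
  "tournament_network n K p q g e =
     \<lparr> graph = \<lparr> pverts = {0..Suc n},
                 parcs = {0} \<times> {1..n} \<union> {1..n} \<times> {Suc n} \<union> (SIGMA j:{1..n}. {1..<j}) \<rparr>,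
       source = 0, sink = Suc n,
       coeff_a = (\<lambda>i j. if i = 0 then p j else 0),
       coeff_b = (\<lambda>i j. if i = 0 then q j else 0),
       coeff_c = (\<lambda>i j. if i = 0 then K else if j = Suc n then K + g i else e j i) \<rparr>"

lemma two_param_network_tournament: "two_param_network (tournament_network n K p q g e)"
  unfolding two_param_network_def pair_fin_digraph_def pair_wf_digraph_def
    pair_fin_digraph_axioms_def tournament_network_def
  by auto

lemma internal_nodes_tournament: "internal_nodes (tournament_network n K p q g e) = {1..n}"
  unfolding internal_nodes_def tournament_network_def by auto

lemma source_tournament: "source (tournament_network n K p q g e) = 0"
  by (simp add: tournament_network_def)

lemma source_sink_monotone_tournament:
  assumes "\<And>j. 0 \<le> p j" "\<And>j. 0 \<le> q j"
  shows "source_sink_monotone (tournament_network n K p q g e)"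
  using assms unfolding source_sink_monotone_def tournament_network_def by auto

lemma admissible_tournament:
  assumes "\<And>i j. i < j \<Longrightarrow> 0 \<le> e i j"
    and "\<And>j. j \<in> {1..n} \<Longrightarrow> 0 \<le> K + g j"
    and "\<And>j. j \<in> {1..n} \<Longrightarrow> 0 \<le> K + (p j * x + q j * y)"
  shows "admissible (tournament_network n K p q g e) x y"
  using assms unfolding admissible_def tournament_network_def capacity_def
  by (auto simp: algebra_simps)

text \<open>The source arcs cut are those to nodes outside \<open>T\<close>: the sum over all nodes
  minus that over \<open>T\<close>. In the latter, \<open>K\<close> cancels against the
  \<open>K\<close> of the sink arcs leaving \<open>T\<close>.\<close>

lemma cut_capacity_tournament:
  assumes T: "T \<subseteq> {1..n}"
  shows "cut_capacity (tournament_network n K p q g e) x y ({0} \<union> T)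
    = (\<Sum>j\<in>{1..n}. K + (p j * x + q j * y)) + reduced_cost p q g e x y T"
proof -
  let ?P = "tournament_network n K p q g e"
  let ?u = "\<lambda>(i, j). capacity ?P x y i j"
  have fin: "finite T" using T finite_subset by blast
  have arcs: "leaving_arcs ?P ({0} \<union> T)
      = {0} \<times> ({1..n} - T) \<union> (T \<times> {Suc n} \<union> (SIGMA j:T. {1..<j} - T))"
    using T unfolding leaving_arcs_def tournament_network_def by auto
  have "sum ?u (leaving_arcs ?P ({0} \<union> T))
      = sum ?u ({0} \<times> ({1..n} - T)) + sum ?u (T \<times> {Suc n} \<union> (SIGMA j:T. {1..<j} - T))"
    unfolding arcs using T fin by (intro sum.union_disjoint) auto
  also have "sum ?u (T \<times> {Suc n} \<union> (SIGMA j:T. {1..<j} - T))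
      = sum ?u (T \<times> {Suc n}) + sum ?u (SIGMA j:T. {1..<j} - T)"
    using T fin by (intro sum.union_disjoint) auto
  also have "sum ?u ({0} \<times> ({1..n} - T)) = (\<Sum>j\<in>{1..n} - T. K + (p j * x + q j * y))"
    unfolding sum.cartesian_product[symmetric]
    by (simp add: capacity_def tournament_network_def algebra_simps)
  also have "\<dots> = (\<Sum>j\<in>{1..n}. K + (p j * x + q j * y)) - (\<Sum>j\<in>T. K + (p j * x + q j * y))"
    using T by (intro sum_diff) auto
  also have "sum ?u (T \<times> {Suc n}) = (\<Sum>j\<in>T. K + g j)"
    unfolding sum.cartesian_product[symmetric] using T
    by (auto simp: capacity_def tournament_network_def intro!: sum.cong)
  also have "sum ?u (SIGMA j:T. {1..<j} - T) = (\<Sum>j\<in>T. \<Sum>i\<in>{1..<j} - T. e i j)"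
    using T fin by (subst sum.Sigma[symmetric])
      (auto simp: capacity_def tournament_network_def intro!: sum.cong)
  finally show ?thesis
    unfolding cut_capacity_def reduced_cost_def
    by (simp add: sum.distrib sum_subtractf)
qed

theorem theorem1:
  fixes n :: nat
  assumes "n \<ge> 1"
  shows "\<exists>P :: nat param_network.
    two_param_network P \<and> source_sink_monotone P \<and> card (internal_nodes P) = n \<and>
    (\<forall>S \<subseteq> internal_nodes P. \<exists>lam mu.
       admissible P lam mu \<and> unique_min_st_cut P lam mu ({source P} \<union> S))"
proof -
  obtain p q g :: "nat \<Rightarrow> real" and e :: "nat \<Rightarrow> nat \<Rightarrow> real" and X Y :: "nat set \<Rightarrow> real"
    where pq: "\<And>j. 0 \<le> p j" "\<And>j. 0 \<le> q j" and e: "\<And>i j. i < j \<Longrightarrow> 0 \<le> e i j"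
      and less: "\<And>S T. S \<subseteq> {1..n} \<Longrightarrow> T \<subseteq> {1..n} \<Longrightarrow> T \<noteq> S \<Longrightarrow>
        reduced_cost p q g e (X S) (Y S) S < reduced_cost p q g e (X S) (Y S) T"
    by (rule exists_separating_weights[OF assms]) (rule that; assumption)
  \<comment> \<open>One network must serve every \<open>S\<close>, so a single \<open>K\<close> has
    to dominate the finitely many values arising from all \<open>S\<close> and
    \<open>j\<close>.\<close>
  define V where "V = (\<lambda>j. - g j) ` {1..n}
    \<union> (\<lambda>(S, j). - (p j * X S + q j * Y S)) ` (Pow {1..n} \<times> {1..n})"
  have "bdd_above V" unfolding V_def by (intro bdd_above_finite) auto
  then obtain K where K: "\<And>v. v \<in> V \<Longrightarrow> v \<le> K" by (auto simp: bdd_above_def)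
  let ?P = "tournament_network n K p q g e"
  have "admissible ?P (X S) (Y S) \<and> unique_min_st_cut ?P (X S) (Y S) ({0} \<union> S)"
    if S: "S \<subseteq> {1..n}" for S
  proof
    show "admissible ?P (X S) (Y S)"
    proof (rule admissible_tournament[OF e])
      fix j assume j: "j \<in> {1..n}"
      have "- g j \<in> V" using j by (auto simp: V_def)
      from K[OF this] show "0 \<le> K + g j" by simp
      have "(\<lambda>(S, j). - (p j * X S + q j * Y S)) (S, j) \<in> V"
        unfolding V_def using j S by (intro UnI2 imageI) auto
      from K[OF this] show "0 \<le> K + (p j * X S + q j * Y S)" by simp
    qed
    show "unique_min_st_cut ?P (X S) (Y S) ({0} \<union> S)"
      unfolding unique_min_st_cut_def st_cut_def internal_nodes_tournament source_tournament
    proof (intro conjI allI impI)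
      fix Z assume "(\<exists>T\<subseteq>{1..n}. Z = {0} \<union> T) \<and> Z \<noteq> {0} \<union> S"
      then obtain T where T: "T \<subseteq> {1..n}" "Z = {0} \<union> T" "T \<noteq> S" by auto
      then show "cut_capacity ?P (X S) (Y S) ({0} \<union> S) < cut_capacity ?P (X S) (Y S) Z"
        using less[OF S T(1,3)] cut_capacity_tournament[OF S] cut_capacity_tournament[OF T(1)] by simp
    qed (use S in blast)
  qed
  then show ?thesis
    using two_param_network_tournament source_sink_monotone_tournament[OF pq]
    by (intro exI[of _ ?P]) (auto simp: internal_nodes_tournament source_tournament)
qed

end
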